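(* For every integer $m$ and every positive integer $n$, \[ \sum_{j=1}^n\binom{n}{j}\Big\lfloor\frac{j}{2}\Big\rfloor 2^jF_{j+m}= \begin{cases} nF_{3n+m-2}-\frac14F_{3n+m}+\frac{5^{n/2}}{4}F_m, & n\text{ even};\\[4pt] nF_{3n+m-2}-\frac14F_{3n+m}-\frac{5^{(n-1)/2}}{4}L_m, & n\text{ odd}, \end{cases} \] and \[ \sum_{j=1}^n\binom{n}{j}\Big\lfloor\frac{j}{2}\Big\rfloor 2^jL_{j+m}= \begin{cases} nL_{3n+m-2}-\frac14L_{3n+m}+\frac{5^{n/2}}{4}L_m, & n\text{ even};\\[4pt] nL_{3n+m-2}-\frac14L_{3n+m}-\frac{5^{(n+1)/2}}{4}F_m, & n\text{ odd}. \end{cases} \]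
   Context: $F_n$ and $L_n$ are the Fibonacci and Lucas numbers, defined for all integers $n$ by $F_n=(\alpha^n-\beta^n)/\sqrt5$, $L_n=\alpha^n+\beta^n$ with $\alpha=(1+\sqrt5)/2$, $\beta=(1-\sqrt5)/2$. $\lfloor x\rfloor$ is the floor function. *)

theory Defs
  imports Complex_Main "HOL-Number_Theory.Fib"
begin

definition golden :: real where
  "golden = (1 + sqrt 5) / 2"

definition golden_conj :: real where
  "golden_conj = (1 - sqrt 5) / 2"

text \<open>Fibonacci and Lucas numbers at an arbitrary integer index, by the Binet formulas.
  The library function \<open>fib\<close> covers natural indices only.\<close>

definition Fibonacci :: "int \<Rightarrow> real" where
  "Fibonacci k = (golden powi k - golden_conj powi k) / sqrt 5"

definition Lucas :: "int \<Rightarrow> real" where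
  "Lucas k = golden powi k + golden_conj powi k"

lemma Fibonacci_of_nat: "Fibonacci (int n) = real (fib n)"
  by (simp add: Fibonacci_def golden_def golden_conj_def fib_closed_form)

end

theory Submission
  imports Defs
begin

text \<open>Since \<open>\<lfloor>j/2\<rfloor> = j/2 - (1 - (-1)^j)/4\<close>, the sum with \<open>x^j\<close> in place of
  the Fibonacci number follows from the binomial theorem and its derivative. For \<open>x\<close> a root of
  \<open>x\<^sup>2 = x + 1\<close> we have \<open>1 + 2x = x\<^sup>3\<close> and \<open>1 - 2x = \<mp>\<surd>5\<close>;
  the Binet formulas combine the two roots.\<close>

text \<open>The remainder of \<open>j\<close> modulo 2 equals \<open>(1 - (-1) ^ j) / 2\<close>, and
  half of it is what the floor removes.\<close>

lemma floor_half: "real_of_int \<lfloor>real j / 2\<rfloor> = real j / 2 - (1 - (-1) ^ j) / 4"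
proof -
  have "\<lfloor>real j / 2\<rfloor> = int (j div 2)"
    by (metis floor_divide_of_nat_eq of_nat_numeral)
  moreover have "real j = 2 * real (j div 2) + (if even j then 0 else 1)"
    by (cases "even j") (auto elim!: evenE oddE)
  ultimately show ?thesis
    by (auto simp: add_divide_distrib)
qed

text \<open>With y = 2x, the \<open>j / 2\<close> part is half of y times the derivative of (1 +
  y)^n; the parity part is a difference of two binomial sums, at y and at -y.\<close>

lemma sum_binomial_floor_half:
  fixes x :: real
  assumes "n > 0"
  shows "(\<Sum>j=1..n. real (n choose j) * real_of_int \<lfloor>real j / 2\<rfloor> * (2 * x) ^ j) =
    real n * x * (1 + 2 * x) ^ (n - 1) - ((1 + 2 * x) ^ n - (1 - 2 * x) ^ n) / 4"
proof -
  have binom: "(\<Sum>j\<le>n. real (n choose j) * y ^ j) = (1 + y) ^ n" for y :: real and n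
    using binomial_ring[of y 1 n] by (simp add: add.commute)
  define k where "k = n - 1"
  have n: "n = Suc k"
    using assms by (simp add: k_def)
  \<comment> \<open>The absorption identity replaces differentiation of the binomial
    theorem.\<close>
  have absorb: "real (Suc i) * real (n choose Suc i) = real n * real (k choose i)" for i
    using Suc_times_binomial[of i k] unfolding n by (metis of_nat_mult)
  \<comment> \<open>The term at \<open>j = 0\<close> vanishes through its factor \<open>j\<close>,
    so the truncated exponent \<open>j - 1\<close> is harmless there.\<close>
  have "(\<Sum>j\<le>n. real j * real (n choose j) * y ^ (j - 1)) =
      (\<Sum>i\<le>k. real (Suc i) * real (n choose Suc i) * y ^ i)" for y :: real
    unfolding n sum.atMost_Suc_shift by (simp del: of_nat_Suc binomial_Suc_Suc)
  then have "(\<Sum>j\<le>n. real j * real (n choose j) * y ^ (j - 1)) =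
      real n * (\<Sum>i\<le>k. real (k choose i) * y ^ i)" for y :: real
    by (simp only: absorb sum_distrib_left mult.assoc)
  then have "(\<Sum>j\<le>n. real j * real (n choose j) * (2 * x) ^ (j - 1)) = real n * (1 + 2 * x) ^ (n - 1)"
    by (simp only: binom k_def)
  then have deriv: "(\<Sum>j\<le>n. 2 * x * (real j * real (n choose j) * (2 * x) ^ (j - 1))) =
      2 * x * (real n * (1 + 2 * x) ^ (n - 1))"
    by (simp flip: sum_distrib_left)
  \<comment> \<open>The added term at \<open>j = 0\<close> is zero because its floor is zero; the
    binomial theorem needs the full range.\<close>
  have "(\<Sum>j=1..n. real (n choose j) * real_of_int \<lfloor>real j / 2\<rfloor> * (2 * x) ^ j) =
      (\<Sum>j\<le>n. real (n choose j) * real_of_int \<lfloor>real j / 2\<rfloor> * (2 * x) ^ j)"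
    by (intro sum.mono_neutral_left) (auto simp: not_le)
  also have "\<dots> = (\<Sum>j\<le>n. (2 * x * (real j * real (n choose j) * (2 * x) ^ (j - 1))) / 2
      - (real (n choose j) * (2 * x) ^ j - real (n choose j) * (- (2 * x)) ^ j) / 4)"
  proof (rule sum.cong[OF refl])
    fix j
    have "2 * x * (real j * real (n choose j) * (2 * x) ^ (j - 1)) =
        real (n choose j) * real j * (2 * x) ^ j"
      by (cases j) simp_all
    then show "real (n choose j) * real_of_int \<lfloor>real j / 2\<rfloor> * (2 * x) ^ j =
        (2 * x * (real j * real (n choose j) * (2 * x) ^ (j - 1))) / 2
        - (real (n choose j) * (2 * x) ^ j - real (n choose j) * (- (2 * x)) ^ j) / 4"
      unfolding floor_half power_minus[of "2 * x"]
      by (simp only:) (simp add: algebra_simps diff_divide_distrib)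
  qed
  also have "\<dots> = real n * x * (1 + 2 * x) ^ (n - 1) - ((1 + 2 * x) ^ n - (1 - 2 * x) ^ n) / 4"
    unfolding sum_subtractf sum_divide_distrib[symmetric] deriv binom by simp
  finally show ?thesis .
qed

text \<open>Substituting x^3 for 1 + 2x turns the first two terms into pure powers of
  \<open>x\<close>. The power of \<open>1 - 2 * x\<close> stays, since its sign depends on the root
  chosen.\<close>

lemma sum_binomial_floor_half_root:
  fixes x :: real
  assumes "n > 0" and root: "x\<^sup>2 = x + 1"
  shows "(\<Sum>j=1..n. real (n choose j) * real_of_int \<lfloor>real j / 2\<rfloor> * 2 ^ j * x powi (int j + m)) =
    real n * x powi (3 * int n + m - 2) - 1/4 * x powi (3 * int n + m)
      + (1 - 2 * x) ^ n / 4 * x powi m"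
proof -
  have x0: "x \<noteq> 0" using root by auto
  \<comment> \<open>Multiplying the root equation by \<open>x\<close> gives x^3 = x^2 + x = 2x +
    1.\<close>
  have cube: "1 + 2 * x = x ^ 3"
    using root by algebra
  have pow: "x powi (3 * int n + m) = x ^ (3 * n) * x powi m"
    using x0 power_int_add[of x "int (3 * n)" m] by (simp del: of_nat_mult add: power_int_of_nat)
       (simp add: power_int_def)
  have pow': "x powi (3 * int n + m - 2) = x * x ^ (3 * (n - 1)) * x powi m"
  proof -
    \<comment> \<open>The factor x (x^3)^(n-1) has exponent 3(n-1) + 1 = 3n - 2, a natural number
      because \<open>n > 0\<close>.\<close>
    have "3 * int n + m - 2 = int (Suc (3 * (n - 1))) + m"
      using \<open>n > 0\<close> by (simp add: of_nat_diff)
    then show ?thesis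
      using x0 power_int_add[of x "int (Suc (3 * (n - 1)))" m] by (metis power_Suc power_int_of_nat)
  qed
  have "(\<Sum>j=1..n. real (n choose j) * real_of_int \<lfloor>real j / 2\<rfloor> * 2 ^ j * x powi (int j + m)) =
      (\<Sum>j=1..n. real (n choose j) * real_of_int \<lfloor>real j / 2\<rfloor> * (2 * x) ^ j) * x powi m"
    using x0 by (simp add: sum_distrib_right power_int_add power_mult_distrib mult.assoc)
  also have "\<dots> = real n * x powi (3 * int n + m - 2) - 1/4 * x powi (3 * int n + m)
      + (1 - 2 * x) ^ n / 4 * x powi m"
    unfolding sum_binomial_floor_half[OF \<open>n > 0\<close>] pow pow' cube power_mult[symmetric]
    by (simp add: algebra_simps diff_divide_distrib)
  finally show ?thesis .
qed

theorem theorem19: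
  fixes m :: int and n :: nat
  assumes "n > 0"
  shows
    "(\<Sum>j=1..n. real (n choose j) * real_of_int \<lfloor>real j / 2\<rfloor> * 2 ^ j * Fibonacci (int j + m)) =
      (if even n
       then real n * Fibonacci (3 * int n + m - 2) - 1/4 * Fibonacci (3 * int n + m)
              + 5 ^ (n div 2) / 4 * Fibonacci m
       else real n * Fibonacci (3 * int n + m - 2) - 1/4 * Fibonacci (3 * int n + m)
              - 5 ^ ((n - 1) div 2) / 4 * Lucas m)
     \<and>
     (\<Sum>j=1..n. real (n choose j) * real_of_int \<lfloor>real j / 2\<rfloor> * 2 ^ j * Lucas (int j + m)) =
      (if even n
       then real n * Lucas (3 * int n + m - 2) - 1/4 * Lucas (3 * int n + m)
              + 5 ^ (n div 2) / 4 * Lucas m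
       else real n * Lucas (3 * int n + m - 2) - 1/4 * Lucas (3 * int n + m)
              - 5 ^ ((n + 1) div 2) / 4 * Fibonacci m)"
proof -
  have root: "golden\<^sup>2 = golden + 1" "golden_conj\<^sup>2 = golden_conj + 1"
    by (simp_all add: golden_def golden_conj_def power2_eq_square field_simps)
  have "1 - 2 * golden = - sqrt 5" "1 - 2 * golden_conj = sqrt 5"
    by (simp_all add: golden_def golden_conj_def field_simps)
  note S = sum_binomial_floor_half_root[OF assms root(1), of m, unfolded this]
    sum_binomial_floor_half_root[OF assms root(2), of m, unfolded this]
  \<comment> \<open>Only the last term depends on the parity of \<open>n\<close>, so it is left in
    terms of the two roots.\<close>
  have F: "(\<Sum>j=1..n. real (n choose j) * real_of_int \<lfloor>real j / 2\<rfloor> * 2 ^ j * Fibonacci (int j + m)) =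
      real n * Fibonacci (3 * int n + m - 2) - 1/4 * Fibonacci (3 * int n + m)
      + ((- sqrt 5) ^ n * golden powi m - sqrt 5 ^ n * golden_conj powi m) / (4 * sqrt 5)"
    unfolding Fibonacci_def times_divide_eq_right right_diff_distrib
      sum_divide_distrib[symmetric] sum_subtractf S
    by (simp add: algebra_simps add_divide_distrib diff_divide_distrib)
  have L: "(\<Sum>j=1..n. real (n choose j) * real_of_int \<lfloor>real j / 2\<rfloor> * 2 ^ j * Lucas (int j + m)) =
      real n * Lucas (3 * int n + m - 2) - 1/4 * Lucas (3 * int n + m)
      + ((- sqrt 5) ^ n * golden powi m + sqrt 5 ^ n * golden_conj powi m) / 4"
    unfolding Lucas_def distrib_left sum.distrib S
    by (simp add: field_simps)
  show ?thesis
  proof (cases "even n")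
    case True
    then obtain k where n: "n = 2 * k" by (elim evenE)
    have pow: "sqrt 5 ^ n = 5 ^ k" "(- sqrt 5) ^ n = 5 ^ k"
      by (simp_all add: n power_mult)
    show ?thesis
      unfolding F L pow using True
      by (simp add: n Fibonacci_def[of m] Lucas_def[of m] algebra_simps diff_divide_distrib)
  next
    case False
    then obtain k where n: "n = 2 * k + 1" by (elim oddE)
    \<comment> \<open>For odd \<open>n\<close> the two powers have opposite signs, which exchanges
      sum and difference of the conjugate powers and hence \<open>Lucas\<close> and
      \<open>Fibonacci\<close>.\<close>
    have pow: "sqrt 5 ^ n = 5 ^ k * sqrt 5" "(- sqrt 5) ^ n = - (5 ^ k * sqrt 5)"
      by (simp_all add: n power_mult)
    \<comment> \<open>In the Lucas sum, the second \<open>sqrt 5\<close> comes from the Binet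
      denominator; together they raise 5^k to 5^(k+1), where k + 1 = (n + 1)/2.\<close>
    have sq: "sqrt 5 * (sqrt 5 * z) = 5 * z" for z
      by (simp flip: mult.assoc)
    show ?thesis
      unfolding F L pow using False
      by (simp add: n Fibonacci_def[of m] Lucas_def[of m] sq field_simps)
  qed
qed

end
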